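(* Let $G$ be a simple connected graph. Then $\gamma(G)\le 2$ (i.e. $G\in\Gamma_{\le 2}$) if and only if $G$ is an induced subgraph of $K_{m,n,o}$ or of $T_n\vee(K_m+K_o)$ for some non-negative integers $m,n,o$.
   Context: For a finite graph $G$ and indeterminates $X_G=\{x_u : u\in V(G)\}$, the generalized Laplacian matrix $L(G,X_G)$ is the $V(G)\times V(G)$ matrix over $\mathbb{Z}[X_G]$ with $(u,u)$-entry $x_u$ and $(u,v)$-entry $-m_{uv}$ for $u\ne v$, $m_{uv}$ being the number of edges between $u$ and $v$. The $i$-th critical ideal $I_i(G,X_G)$ is the ideal of $\mathbb{Z}[X_G]$ generated by all $i\times i$ minors of $L(G,X_G)$ (with $I_i=\langle1\rangle$ for $i<1$, $I_i=\langle 0\rangle$ for $i>|V(G)|$). The algebraic co-rank $\gamma(G)$ is the number of critical ideals of $G$ equal to $\langle 1\rangle$; $\Gamma_{\le 2}$ is the set of simple connected graphs with $\gamma\le 2$. $K_{m,n,o}$ is the complete tripartite graph with parts of sizes $m,n,o$; $T_n$ is the edgeless graph on $n$ vertices; $K_m$ the complete graph on $m$ vertices; $G+H$ is the disjoint union and $G\vee H$ the join (disjoint union plus all edges between $G$ and $H$). *)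

theory Defs
  imports "HOL-Library.Poly_Mapping" "Jordan_Normal_Form.Determinant" "Jordan_Normal_Form.DL_Submatrix"
begin

text \<open>Multivariate integer polynomials in variables indexed by nat: the ring Z[x_0, x_1, ...].\<close>
type_synonym mpoly_int = "(nat \<Rightarrow>\<^sub>0 nat) \<Rightarrow>\<^sub>0 int"

definition var :: "nat \<Rightarrow> mpoly_int" where
  "var u = Poly_Mapping.single (Poly_Mapping.single u 1) 1"

text \<open>Ideal of a commutative ring generated by a set.\<close>
definition ideal_gen :: "'a::comm_ring_1 set \<Rightarrow> 'a set" where
  "ideal_gen S = {x. \<exists>F c. finite F \<and> F \<subseteq> S \<and> x = (\<Sum>s\<in>F. c s * s)}"

text \<open>Graphs: vertex set {0..<N}, adjacency relation E.\<close>
definition simple_graph :: "nat \<Rightarrow> (nat \<Rightarrow> nat \<Rightarrow> bool) \<Rightarrow> bool" where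
  "simple_graph N E \<longleftrightarrow> (\<forall>u<N. \<forall>v<N. E u v \<longleftrightarrow> E v u) \<and> (\<forall>u<N. \<not> E u u)"

definition connected_graph :: "nat \<Rightarrow> (nat \<Rightarrow> nat \<Rightarrow> bool) \<Rightarrow> bool" where
  "connected_graph N E \<longleftrightarrow> N > 0 \<and>
     (\<forall>u<N. \<forall>v<N. (u, v) \<in> {(a, b). a < N \<and> b < N \<and> E a b}\<^sup>*)"

text \<open>Generalized Laplacian L(G, X_G) of a simple graph (multiplicities 0/1).\<close>
definition gen_laplacian :: "nat \<Rightarrow> (nat \<Rightarrow> nat \<Rightarrow> bool) \<Rightarrow> mpoly_int mat" where
  "gen_laplacian N E = mat N N (\<lambda>(u, v). if u = v then var u else if E u v then -1 else 0)"

text \<open>The i-th critical ideal, for 1 \<le> i \<le> N: generated by all i x i minors.\<close>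
definition minors :: "mpoly_int mat \<Rightarrow> nat \<Rightarrow> mpoly_int set" where
  "minors A i = {det (submatrix A R C) | R C.
      R \<subseteq> {0..<dim_row A} \<and> C \<subseteq> {0..<dim_col A} \<and> card R = i \<and> card C = i}"

definition critical_ideal :: "nat \<Rightarrow> (nat \<Rightarrow> nat \<Rightarrow> bool) \<Rightarrow> nat \<Rightarrow> mpoly_int set" where
  "critical_ideal N E i =
     (if i < 1 then UNIV else if i > N then {0} else ideal_gen (minors (gen_laplacian N E) i))"

text \<open>Algebraic co-rank: number of critical ideals equal to the unit ideal
  (the indices i < 1 are excluded, as in the paper's count).\<close>
definition alg_corank :: "nat \<Rightarrow> (nat \<Rightarrow> nat \<Rightarrow> bool) \<Rightarrow> nat" where
  "alg_corank N E = card {i \<in> {1..N}. critical_ideal N E i = UNIV}"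

text \<open>G (vertices {0..<N}, adjacency E) is an induced subgraph of H (vertex set W, adjacency F).\<close>
definition induced_subgraph_of ::
  "nat \<Rightarrow> (nat \<Rightarrow> nat \<Rightarrow> bool) \<Rightarrow> 'b set \<Rightarrow> ('b \<Rightarrow> 'b \<Rightarrow> bool) \<Rightarrow> bool" where
  "induced_subgraph_of N E W F \<longleftrightarrow>
     (\<exists>f. inj_on f {0..<N} \<and> f ` {0..<N} \<subseteq> W \<and>
          (\<forall>u<N. \<forall>v<N. E u v \<longleftrightarrow> F (f u) (f v)))"

text \<open>Three-part vertex set: part 0 of size a, part 1 of size b, part 2 of size c.\<close>
definition three_parts :: "nat \<Rightarrow> nat \<Rightarrow> nat \<Rightarrow> (nat \<times> nat) set" where
  "three_parts a b c = {(0, k) | k. k < a} \<union> {(1, k) | k. k < b} \<union> {(2, k) | k. k < c}"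

text \<open>K_{m,n,o}: parts 0,1,2 of sizes m,n,o; adjacent iff in different parts.\<close>
definition K3_verts :: "nat \<Rightarrow> nat \<Rightarrow> nat \<Rightarrow> (nat \<times> nat) set" where
  "K3_verts m n q = three_parts m n q"

definition K3_adj :: "nat \<times> nat \<Rightarrow> nat \<times> nat \<Rightarrow> bool" where
  "K3_adj x y \<longleftrightarrow> fst x \<noteq> fst y"

text \<open>T_n \<or> (K_m + K_o): part 0 = T_n (size n, independent), part 1 = K_m, part 2 = K_o;
  part 0 is joined to all of parts 1 and 2; parts 1 and 2 are cliques with no edges between them.\<close>
definition TK_verts :: "nat \<Rightarrow> nat \<Rightarrow> nat \<Rightarrow> (nat \<times> nat) set" where
  "TK_verts n m q = three_parts n m q"

definition TK_adj :: "nat \<times> nat \<Rightarrow> nat \<times> nat \<Rightarrow> bool" where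
  "TK_adj x y \<longleftrightarrow> x \<noteq> y \<and>
     ((fst x = 0 \<and> fst y \<noteq> 0) \<or> (fst x \<noteq> 0 \<and> fst y = 0) \<or>
      (fst x \<noteq> 0 \<and> fst x = fst y))"

end

theory Submission
  imports Defs "HOL-Library.Z2"
begin

text \<open>
  Evaluate the variables modulo 2 at 0 on the independent parts and at 1 on the cliques. In both
  families the generalized Laplacian then only depends on the parts of its two indices, and the
  three resulting rows sum to zero. So it factors through dimension 2, all minors of order at
  least 3 vanish modulo 2, and the corresponding critical ideals are proper.

  Conversely, the critical ideals of order 1, 2, 3 are trivial as soon as the graph contains an
  induced P4, cricket, dart, K5 minus P3 or K6 minus two disjoint edges. Let G be connected without
  these. If non-adjacency is transitive, G is complete multipartite, and avoiding the last graph
  leaves at most three parts or at most one part with more than one vertex. Otherwise there are an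
  edge bc and a vertex a adjacent to neither b nor c. Avoiding P4 gives a common neighbour w of
  a, b and c, and every vertex is either a non-neighbour of w seeing a, b and c, or a neighbour of w
  on the side of a or on the side of bc.
\<close>

section \<open>Evaluation of polynomials\<close>

definition mono_eval :: "(nat \<Rightarrow> 'a::comm_ring_1) \<Rightarrow> (nat \<Rightarrow>\<^sub>0 nat) \<Rightarrow> 'a" where
  "mono_eval x m = (\<Prod>u\<in>Poly_Mapping.keys m. x u ^ Poly_Mapping.lookup m u)"

text \<open>The target ring is arbitrary so that taking \<open>bit\<close> evaluates modulo
  2.\<close>

definition poly_eval :: "(nat \<Rightarrow> 'a::comm_ring_1) \<Rightarrow> mpoly_int \<Rightarrow> 'a" where
  "poly_eval x p = (\<Sum>m\<in>Poly_Mapping.keys p. of_int (Poly_Mapping.lookup p m) * mono_eval x m)"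

text \<open>Exponents outside the keys are 0 and contribute the factor 1, so two monomials can be
  compared over one common index set.\<close>

lemma mono_eval_superset:
  assumes "finite U" "Poly_Mapping.keys m \<subseteq> U"
  shows "mono_eval x m = (\<Prod>u\<in>U. x u ^ Poly_Mapping.lookup m u)"
  unfolding mono_eval_def
  using assms by (intro prod.mono_neutral_left) (auto simp: in_keys_iff)

lemma mono_eval_add: "mono_eval x (m + n) = mono_eval x m * mono_eval x n"
proof -
  let ?U = "Poly_Mapping.keys m \<union> Poly_Mapping.keys n"
  have "mono_eval x (m + n) = (\<Prod>u\<in>?U. x u ^ Poly_Mapping.lookup (m + n) u)"
    by (rule mono_eval_superset) (auto simp: Poly_Mapping.keys_add)
  also have "\<dots> = (\<Prod>u\<in>?U. x u ^ Poly_Mapping.lookup m u) *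
      (\<Prod>u\<in>?U. x u ^ Poly_Mapping.lookup n u)"
    by (simp add: lookup_add power_add prod.distrib)
  finally show ?thesis
    by (simp add: mono_eval_superset[of ?U])
qed

lemma poly_eval_superset:
  assumes "finite U" "Poly_Mapping.keys p \<subseteq> U"
  shows "poly_eval x p = (\<Sum>m\<in>U. of_int (Poly_Mapping.lookup p m) * mono_eval x m)"
  unfolding poly_eval_def
  using assms by (intro sum.mono_neutral_left) (auto simp: in_keys_iff)

lemma poly_eval_add: "poly_eval x (p + q) = poly_eval x p + poly_eval x q"
proof -
  let ?U = "Poly_Mapping.keys p \<union> Poly_Mapping.keys q"
  have "poly_eval x (p + q) = (\<Sum>m\<in>?U. of_int (Poly_Mapping.lookup (p + q) m) * mono_eval x m)"
    by (rule poly_eval_superset) (auto simp: Poly_Mapping.keys_add)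
  also have "\<dots> = (\<Sum>m\<in>?U. of_int (Poly_Mapping.lookup p m) * mono_eval x m) +
      (\<Sum>m\<in>?U. of_int (Poly_Mapping.lookup q m) * mono_eval x m)"
    by (simp add: lookup_add distrib_right sum.distrib)
  finally show ?thesis
    by (simp add: poly_eval_superset[of ?U])
qed

lemma poly_eval_zero: "poly_eval x 0 = 0"
  by (simp add: poly_eval_def)

lemma poly_eval_sum: "poly_eval x (\<Sum>i\<in>I. f i) = (\<Sum>i\<in>I. poly_eval x (f i))"
  by (induction I rule: infinite_finite_induct) (auto simp: poly_eval_add poly_eval_zero)

lemma poly_eval_single: "poly_eval x (Poly_Mapping.single m c) = of_int c * mono_eval x m"
  by (subst poly_eval_superset[of "{m}"]) (auto simp: lookup_single)

lemma sum_monomials: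
  fixes p :: "'a \<Rightarrow>\<^sub>0 'b::comm_monoid_add"
  shows "p = (\<Sum>m\<in>Poly_Mapping.keys p. Poly_Mapping.single m (Poly_Mapping.lookup p m))"
proof (rule poly_mapping_eqI)
  fix k
  show "Poly_Mapping.lookup p k = Poly_Mapping.lookup
      (\<Sum>m\<in>Poly_Mapping.keys p. Poly_Mapping.single m (Poly_Mapping.lookup p m)) k"
    by (simp add: lookup_sum lookup_single when_def sum.delta in_keys_iff)
qed

lemma poly_eval_mult: "poly_eval x (p * q) = poly_eval x p * poly_eval x q"
proof -
  have "p * q = (\<Sum>m\<in>Poly_Mapping.keys p. \<Sum>n\<in>Poly_Mapping.keys q.
      Poly_Mapping.single (m + n) (Poly_Mapping.lookup p m * Poly_Mapping.lookup q n))"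
    by (subst sum_monomials[of p], subst sum_monomials[of q]) (simp add: sum_product mult_single)
  then have "poly_eval x (p * q) = (\<Sum>m\<in>Poly_Mapping.keys p. \<Sum>n\<in>Poly_Mapping.keys q.
      (of_int (Poly_Mapping.lookup p m) * mono_eval x m) *
      (of_int (Poly_Mapping.lookup q n) * mono_eval x n))"
    by (simp add: poly_eval_sum poly_eval_single mono_eval_add algebra_simps)
  then show ?thesis
    by (simp add: poly_eval_def sum_product)
qed

lemma poly_eval_one: "poly_eval x 1 = 1"
  using poly_eval_single[of x 0 1] by (simp add: mono_eval_def)

lemma poly_eval_var: "poly_eval x (var u) = x u"
  by (simp add: var_def poly_eval_single mono_eval_def)

lemma comm_ring_hom_poly_eval: "comm_ring_hom (poly_eval x)"
  by unfold_locales (auto simp: poly_eval_add poly_eval_mult poly_eval_zero poly_eval_one)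


section \<open>Ideals generated by minors\<close>

text \<open>A commutative ring is a module over itself whose submodules are its ideals; facts about
  spans thus become facts about \<open>ideal_gen\<close>.\<close>

lemma module_self: "Modules.module ((*) :: 'a::comm_ring_1 \<Rightarrow> 'a \<Rightarrow> 'a)"
  by unfold_locales (auto simp: algebra_simps)

lemma ideal_gen_eq_span: "ideal_gen S = Modules.module.span (*) S"
  unfolding ideal_gen_def Modules.module.span_explicit[OF module_self] by blast

lemmas ideal_gen_base = Modules.module.span_base[OF module_self, folded ideal_gen_eq_span]
  and ideal_gen_add = Modules.module.span_add[OF module_self, folded ideal_gen_eq_span]
  and ideal_gen_scale = Modules.module.span_scale[OF module_self, folded ideal_gen_eq_span]

lemma ideal_gen_eq_UNIV: "1 \<in> ideal_gen S \<Longrightarrow> ideal_gen S = UNIV"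
  using ideal_gen_scale[of 1 S] by auto

text \<open>A submatrix lists its rows and columns in increasing order; any other order changes the minor
  by a sign only.\<close>

lemma permutes_sorting_indices:
  assumes "inj_on r {0..<k}"
  obtains \<pi> where "\<pi> permutes {0..<k}" "\<And>i. i < k \<Longrightarrow> pick (r ` {0..<k}) (\<pi> i) = r i"
proof -
  let ?R = "r ` {0..<k}"
  \<comment> \<open>The rank of \<open>r i\<close> among the values of \<open>r\<close> is the
    position at which \<open>pick\<close> returns \<open>r i\<close>; outside the range,
    \<open>permutes\<close> demands the identity.\<close>
  define \<pi> where "\<pi> i = (if i < k then card {a\<in>?R. a < r i} else i)" for i
  have pick: "pick ?R (\<pi> i) = r i" if "i < k" for i
    using that by (simp add: \<pi>_def pick_card_in_set)
  have card: "card ?R = k"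
    using assms by (simp add: card_image)
  have "\<pi> ` {0..<k} \<subseteq> {0..<k}"
  proof safe
    fix i assume i: "i \<in> {0..<k}"
    then have "{a\<in>?R. a < r i} \<subset> ?R"
      by blast
    then have "card {a\<in>?R. a < r i} < k"
      using psubset_card_mono[of ?R] card by simp
    then show "\<pi> i \<in> {0..<k}"
      using i by (simp add: \<pi>_def)
  qed
  moreover have "inj_on \<pi> {0..<k}"
    using assms pick unfolding inj_on_def by (metis atLeastLessThan_iff)
  ultimately have "bij_betw \<pi> {0..<k} {0..<k}"
    by (simp add: bij_betw_def endo_inj_surj)
  then have "\<pi> permutes {0..<k}"
    by (rule bij_imp_permutes) (simp add: \<pi>_def)
  with pick show thesis
    by (rule that[rotated])
qed

lemma det_permute_cols:
  assumes A: "(A :: 'a::comm_ring_1 mat) \<in> carrier_mat n n" and p: "p permutes {0..<n}"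
  shows "det (mat n n (\<lambda>(i, j). A $$ (i, p j))) = signof p * det A"
proof -
  have pn: "p j < n" if "j < n" for j
    using permutes_in_image[OF p, of j] that by simp
  have "transpose_mat (mat n n (\<lambda>(i, j). A $$ (i, p j))) =
      mat n n (\<lambda>(i, j). transpose_mat A $$ (p i, j))"
    using A pn by (intro eq_matI) auto
  then show ?thesis
    using det_permute_rows[of "transpose_mat A" n p] A p det_transpose
    by (metis det_transpose mat_carrier transpose_carrier_mat)
qed

text \<open>Minors will be taken along vertices in whatever order makes them easy to expand. The
  sign of the reordering is absorbed by the ideal.\<close>

lemma minor_in_ideal_gen_minors:
  assumes r: "inj_on r {0..<k}" "r ` {0..<k} \<subseteq> {0..<dim_row A}"
    and c: "inj_on c {0..<k}" "c ` {0..<k} \<subseteq> {0..<dim_col A}"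
  shows "det (mat k k (\<lambda>(i, j). A $$ (r i, c j))) \<in> ideal_gen (minors A k)"
proof -
  let ?R = "r ` {0..<k}" and ?C = "c ` {0..<k}"
  let ?S = "submatrix A ?R ?C"
  obtain \<pi> where \<pi>: "\<pi> permutes {0..<k}" "\<And>i. i < k \<Longrightarrow> pick ?R (\<pi> i) = r i"
    using permutes_sorting_indices[OF r(1)] by blast
  obtain \<rho> where \<rho>: "\<rho> permutes {0..<k}" "\<And>i. i < k \<Longrightarrow> pick ?C (\<rho> i) = c i"
    using permutes_sorting_indices[OF c(1)] by blast
  have card: "card ?R = k" "card ?C = k"
    using r c by (simp_all add: card_image)
  have eqs: "{i. i < dim_row A \<and> i \<in> ?R} = ?R" "{i. i < dim_col A \<and> i \<in> ?C} = ?C"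
    using r c by auto
  have S: "?S \<in> carrier_mat k k"
    unfolding submatrix_def eqs card by simp
  have entry: "?S $$ (\<pi> i, \<rho> j) = A $$ (r i, c j)" if "i < k" "j < k" for i j
  proof -
    have "\<pi> i < k" "\<rho> j < k"
      using permutes_in_image[OF \<pi>(1), of i] permutes_in_image[OF \<rho>(1), of j] that by auto
    then show ?thesis
      unfolding submatrix_def eqs card using \<pi>(2) \<rho>(2) that by simp
  qed
  let ?B = "mat k k (\<lambda>(i, j). ?S $$ (i, \<rho> j))"
  have \<pi>k: "\<pi> i < k" if "i < k" for i
    using permutes_in_image[OF \<pi>(1), of i] that by simp
  \<comment> \<open>The columns are permuted first, giving \<open>?B\<close>, and then the rows;
    each permutation contributes its sign.\<close>
  have "mat k k (\<lambda>(i, j). A $$ (r i, c j)) = mat k k (\<lambda>(i, j). ?B $$ (\<pi> i, j))"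
    by (rule eq_matI) (auto simp: entry \<pi>k)
  then have "det (mat k k (\<lambda>(i, j). A $$ (r i, c j))) = signof \<pi> * (signof \<rho> * det ?S)"
    using det_permute_rows[of ?B k \<pi>] det_permute_cols[OF S \<rho>(1)] \<pi>(1) by simp
  moreover have "det ?S \<in> minors A k"
    unfolding minors_def using r c card by blast
  ultimately show ?thesis
    by (metis ideal_gen_base ideal_gen_scale)
qed

section \<open>Upper bound on the co-rank from an evaluation of rank at most two\<close>

lemma det_rank_le_2:
  fixes a b p q :: "nat \<Rightarrow> 'a::comm_ring_1"
  assumes n: "n \<ge> 3"
  shows "det (mat n n (\<lambda>(i, j). a i * p j + b i * q j)) = 0"
proof -
  \<comment> \<open>Both factors of the rank-two product are padded with zeros to size
    \<open>n\<close>, so that the determinant is multiplicative.\<close>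
  let ?P = "mat n n (\<lambda>(i, k). if k = 0 then a i else if k = 1 then b i else 0)"
  let ?Q = "mat n n (\<lambda>(k, j). if k = 0 then p j else if k = 1 then q j else 0)"
  have "mat n n (\<lambda>(i, j). a i * p j + b i * q j) = ?P * ?Q"
  proof (rule eq_matI)
    fix i j assume ij: "i < dim_row (?P * ?Q)" "j < dim_col (?P * ?Q)"
    have "(?P * ?Q) $$ (i, j) = (\<Sum>k\<in>{0..<n}. (if k = 0 then a i else if k = 1 then b i else 0) *
        (if k = 0 then p j else if k = 1 then q j else 0))"
      using ij by (simp add: scalar_prod_def)
    also have "\<dots> = (\<Sum>k\<in>{0, 1 :: nat}. (if k = 0 then a i else if k = 1 then b i else 0) *
        (if k = 0 then p j else if k = 1 then q j else 0))"
      using n by (intro sum.mono_neutral_right) auto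
    finally show "mat n n (\<lambda>(i, j). a i * p j + b i * q j) $$ (i, j) = (?P * ?Q) $$ (i, j)"
      using ij by simp
  qed auto
  moreover have "det ?Q = 0"
  proof -
    \<comment> \<open>Each product in the Leibniz formula has a factor from row 2, which exists
      because \<open>n \<ge> 3\<close> and is zero by the padding.\<close>
    have "(\<Prod>i = 0..<n. ?Q $$ (i, \<sigma> i)) = 0" if "\<sigma> permutes {0..<n}" for \<sigma>
      using n permutes_in_image[OF that, of 2] by (intro prod_zero bexI[of _ 2]) auto
    then show ?thesis
      by (subst det_def'[of _ n]) auto
  qed
  ultimately show ?thesis
    by (simp add: det_mult[of _ n])
qed

text \<open>The evaluation kills every minor of order at least 3, hence the ideal they generate, but
  maps 1 to 1. So only the indices 1 and 2 can be counted.\<close>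

lemma alg_corank_le_2:
  fixes x a b p q :: "nat \<Rightarrow> 'a::comm_ring_1"
  assumes entry: "\<And>u v. u < N \<Longrightarrow> v < N \<Longrightarrow>
    poly_eval x (gen_laplacian N E $$ (u, v)) = a u * p v + b u * q v"
  shows "alg_corank N E \<le> 2"
proof -
  let ?L = "gen_laplacian N E"
  interpret hom: comm_ring_hom "poly_eval x"
    by (rule comm_ring_hom_poly_eval)
  have minor0: "poly_eval x s = 0" if s: "s \<in> minors ?L i" and i: "3 \<le> i" for s i
  proof -
    obtain R C where RC: "s = det (submatrix ?L R C)" "R \<subseteq> {0..<N}" "C \<subseteq> {0..<N}"
        "card R = i" "card C = i"
      using s by (auto simp: minors_def gen_laplacian_def)
    have "{j. j < N \<and> j \<in> R} = R" "{j. j < N \<and> j \<in> C} = C"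
      using RC by auto
    then have "submatrix ?L R C = mat i i (\<lambda>(j, k). ?L $$ (pick R j, pick C k))"
      using RC by (simp add: submatrix_def gen_laplacian_def)
    moreover have "pick R j < N" "pick C j < N" if "j < i" for j
      using that RC pick_in_set_le by (metis atLeastLessThan_iff subsetD)+
    ultimately have "map_mat (poly_eval x) (submatrix ?L R C) =
        mat i i (\<lambda>(j, k). a (pick R j) * p (pick C k) + b (pick R j) * q (pick C k))"
      by (intro eq_matI) (auto simp: entry)
    then show ?thesis
      using det_rank_le_2[OF i, of "\<lambda>j. a (pick R j)" "\<lambda>k. p (pick C k)"
          "\<lambda>j. b (pick R j)" "\<lambda>k. q (pick C k)"]
      unfolding RC(1) hom.hom_det[symmetric] by simp
  qed
  have "critical_ideal N E i \<noteq> UNIV" if i: "3 \<le> i" "i \<le> N" for i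
  proof
    assume "critical_ideal N E i = UNIV"
    then have "1 \<in> ideal_gen (minors ?L i)"
      using i by (auto simp: critical_ideal_def)
    then obtain F c where F: "F \<subseteq> minors ?L i" "1 = (\<Sum>s\<in>F. c s * s)"
      by (auto simp: ideal_gen_def)
    have "(1 :: 'a) = (\<Sum>s\<in>F. poly_eval x (c s) * poly_eval x s)"
      using arg_cong[OF F(2), of "poly_eval x"]
      unfolding poly_eval_one poly_eval_sum poly_eval_mult .
    also have "\<dots> = 0"
      using F(1) minor0[OF _ i(1)] by (intro sum.neutral) auto
    finally show False by simp
  qed
  then have "i < 3" if "1 \<le> i" "i \<le> N" "critical_ideal N E i = UNIV" for i
    using that by (meson not_less)
  then have "{i \<in> {1..N}. critical_ideal N E i = UNIV} \<subseteq> {1..<3}"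
    by auto
  then have "alg_corank N E \<le> card {1..<3 :: nat}"
    unfolding alg_corank_def by (intro card_mono) auto
  then show ?thesis by simp
qed

lemma alg_corank_le_2_K3:
  assumes "induced_subgraph_of N E (K3_verts l m n) K3_adj"
  shows "alg_corank N E \<le> 2"
proof -
  obtain f where f: "f ` {0..<N} \<subseteq> K3_verts l m n"
      "\<And>u v. u < N \<Longrightarrow> v < N \<Longrightarrow> E u v \<longleftrightarrow> K3_adj (f u) (f v)"
    using assms unfolding induced_subgraph_of_def by blast
  define c where "c u = fst (f u)" for u
  have c: "c u \<in> {0, 1, 2}" if "u < N" for u
    using f(1) that by (force simp: c_def K3_verts_def three_parts_def)
  interpret hom: comm_ring_hom "poly_eval (\<lambda>_. 0 :: bit)"
    by (rule comm_ring_hom_poly_eval)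
  show ?thesis
  proof (rule alg_corank_le_2)
    fix u v assume uv: "u < N" "v < N"
    \<comment> \<open>Rows of parts 0 and 1 are the indicators of \<open>c v \<noteq> 0\<close> and
      \<open>c v \<noteq> 1\<close>; a row of part 2 is their sum modulo 2.\<close>
    show "poly_eval (\<lambda>_. 0 :: bit) (gen_laplacian N E $$ (u, v)) =
        of_bool (c u \<noteq> 1) * of_bool (c v \<noteq> 0) + of_bool (c u \<noteq> 0) * of_bool (c v \<noteq> 1)"
      using uv c[of u] c[of v] f(2)[of u v]
      by (auto simp: gen_laplacian_def K3_adj_def poly_eval_var hom.hom_uminus
          c_def[symmetric])
  qed
qed

lemma alg_corank_le_2_TK:
  assumes "induced_subgraph_of N E (TK_verts l m n) TK_adj"
  shows "alg_corank N E \<le> 2"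
proof -
  obtain f where f: "f ` {0..<N} \<subseteq> TK_verts l m n" "inj_on f {0..<N}"
      "\<And>u v. u < N \<Longrightarrow> v < N \<Longrightarrow> E u v \<longleftrightarrow> TK_adj (f u) (f v)"
    using assms unfolding induced_subgraph_of_def by blast
  define c where "c u = fst (f u)" for u
  have c: "c u \<in> {0, 1, 2}" if "u < N" for u
    using f(1) that by (force simp: c_def TK_verts_def three_parts_def)
  define x :: "nat \<Rightarrow> bit" where "x u = of_bool (c u \<noteq> 0)" for u
  interpret hom: comm_ring_hom "poly_eval x"
    by (rule comm_ring_hom_poly_eval)
  show ?thesis
  proof (rule alg_corank_le_2)
    fix u v assume uv: "u < N" "v < N"
    \<comment> \<open>Rows of parts 0 and 1 are the indicators of \<open>c v \<noteq> 0\<close> and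
      \<open>c v \<noteq> 2\<close>; a row of part 2 is again their sum modulo 2. The diagonal fits
      because \<open>x\<close> is 1 exactly on the cliques.\<close>
    show "poly_eval x (gen_laplacian N E $$ (u, v)) =
        of_bool (c u \<noteq> 1) * of_bool (c v \<noteq> 0) + of_bool (c u \<noteq> 0) * of_bool (c v \<noteq> 2)"
    proof (cases "u = v")
      case True
      then show ?thesis
        using uv c[of u] by (auto simp: gen_laplacian_def poly_eval_var x_def)
    next
      case False
      then have "f u \<noteq> f v"
        using f(2) uv by (auto simp: inj_on_def)
      then have "E u v \<longleftrightarrow> c u = 0 \<and> c v \<noteq> 0 \<or> c u \<noteq> 0 \<and> c v = 0 \<or> c u \<noteq> 0 \<and> c u = c v"
        using f(3) uv by (simp add: TK_adj_def c_def)
      then show ?thesis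
        using uv False c[of u] c[of v] by (auto simp: gen_laplacian_def hom.hom_uminus)
    qed
  qed
qed


section \<open>Obstructions\<close>

text \<open>Laplace expansion along row 0, the index shift skipping column \<open>j\<close>. The
  smaller matrices are again of the form \<open>mat\<close>, so rewriting can iterate it.\<close>

lemma det_mat_Suc:
  fixes f :: "nat \<times> nat \<Rightarrow> 'a::comm_ring_1"
  shows "det (mat (Suc n) (Suc n) f) = (\<Sum>j<Suc n. (-1) ^ j * f (0, j) *
    det (mat n n (\<lambda>(i, k). f (Suc i, if k < j then k else Suc k))))"
proof -
  have "mat_delete (mat (Suc n) (Suc n) f) 0 j =
      mat n n (\<lambda>(i, k). f (Suc i, if k < j then k else Suc k))" if "j < Suc n" for j
    using that by (intro eq_matI) (auto simp: mat_delete_def)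
  then show ?thesis
    by (subst laplace_expansion_row[of _ "Suc n" 0])
      (auto simp: cofactor_def mult_ac intro!: sum.cong)
qed

lemma det_mat_2:
  fixes f :: "nat \<times> nat \<Rightarrow> 'a::comm_ring_1"
  shows "det (mat 2 2 f) = f (0, 0) * f (1, 1) - f (0, 1) * f (1, 0)"
  unfolding numeral_2_eq_2 by (simp add: det_mat_Suc)

lemma det_mat_3:
  fixes f :: "nat \<times> nat \<Rightarrow> 'a::comm_ring_1"
  shows "det (mat 3 3 f) = f (0, 0) * (f (1, 1) * f (2, 2) - f (1, 2) * f (2, 1))
     - f (0, 1) * (f (1, 0) * f (2, 2) - f (1, 2) * f (2, 0))
     + f (0, 2) * (f (1, 0) * f (2, 1) - f (1, 1) * f (2, 0))"
  unfolding numeral_3_eq_3 numeral_2_eq_2 by (simp add: det_mat_Suc algebra_simps)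

section \<open>Minors at named vertices and the five forbidden induced subgraphs\<close>

locale labelled_graph =
  fixes N :: nat and E :: "nat \<Rightarrow> nat \<Rightarrow> bool"
  assumes simple: "simple_graph N E"
begin

text \<open>A total function giving the entries of \<open>gen_laplacian\<close> below
  \<open>N\<close>; minors at named vertices then expand without index bounds.\<close>

definition L :: "nat \<Rightarrow> nat \<Rightarrow> mpoly_int" where
  "L u v = (if u = v then var u else if E u v then -1 else 0)"

lemma E_sym: "u < N \<Longrightarrow> v < N \<Longrightarrow> E u v = E v u"
  and E_irrefl: "u < N \<Longrightarrow> \<not> E u u"
  using simple by (auto simp: simple_graph_def)

lemma minor_in_critical_ideal:
  assumes k: "k \<ge> 1" and rs: "length rs = k" "distinct rs" "set rs \<subseteq> {..<N}"
    and cs: "length cs = k" "distinct cs" "set cs \<subseteq> {..<N}"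
  shows "det (mat k k (\<lambda>(i, j). L (rs ! i) (cs ! j))) \<in> critical_ideal N E k"
proof -
  let ?A = "gen_laplacian N E"
  \<comment> \<open>Distinct rows below \<open>N\<close> force \<open>k \<le> N\<close>, which
    excludes the branch where the critical ideal is \<open>{0}\<close>.\<close>
  have "card (set rs) \<le> N"
    using card_mono[OF finite_lessThan rs(3)] by simp
  then have kN: "k \<le> N"
    using rs by (simp add: distinct_card)
  have nth: "xs ! i < N" if "set xs \<subseteq> {..<N}" "i < length xs" for xs i
    using that nth_mem by blast
  have "mat k k (\<lambda>(i, j). L (rs ! i) (cs ! j)) = mat k k (\<lambda>(i, j). ?A $$ (rs ! i, cs ! j))"
    using rs cs nth[of rs] nth[of cs] by (intro eq_matI) (auto simp: gen_laplacian_def L_def)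
  also have "det \<dots> \<in> ideal_gen (minors ?A k)"
  proof (rule minor_in_ideal_gen_minors)
    show "inj_on ((!) rs) {0..<k}" "inj_on ((!) cs) {0..<k}"
      using rs cs by (auto simp: inj_on_def nth_eq_iff_index_eq)
    show "(!) rs ` {0..<k} \<subseteq> {0..<dim_row ?A}" "(!) cs ` {0..<k} \<subseteq> {0..<dim_col ?A}"
      using rs cs nth by (auto simp: gen_laplacian_def)
  qed
  finally show ?thesis
    using k kN by (simp add: critical_ideal_def)
qed

lemma critical_ideal_add:
  "1 \<le> i \<Longrightarrow> i \<le> N \<Longrightarrow> p \<in> critical_ideal N E i \<Longrightarrow> q \<in> critical_ideal N E i \<Longrightarrow>
    p + q \<in> critical_ideal N E i"
  and critical_ideal_scale:
  "1 \<le> i \<Longrightarrow> i \<le> N \<Longrightarrow> p \<in> critical_ideal N E i \<Longrightarrow> c * p \<in> critical_ideal N E i"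
  by (auto simp: critical_ideal_def ideal_gen_add ideal_gen_scale)

lemma critical_ideal_eq_UNIV:
  assumes "1 \<le> i" "i \<le> N" "1 \<in> critical_ideal N E i"
  shows "critical_ideal N E i = UNIV"
  using assms by (auto simp: critical_ideal_def ideal_gen_eq_UNIV)

lemma minor_1: "u < N \<Longrightarrow> v < N \<Longrightarrow> L u v \<in> critical_ideal N E 1"
  using minor_in_critical_ideal[of 1 "[u]" "[v]"] by (simp add: det_single)

lemma minor_2:
  assumes "distinct [a, b]" "distinct [u, v]" "{a, b, u, v} \<subseteq> {..<N}"
  shows "L a u * L b v - L a v * L b u \<in> critical_ideal N E 2"
  using minor_in_critical_ideal[of 2 "[a, b]" "[u, v]"] assms by (simp add: det_mat_2)

lemma minor_3:
  assumes "distinct [a, b, c]" "distinct [u, v, w]" "{a, b, c, u, v, w} \<subseteq> {..<N}"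
  shows "L a u * (L b v * L c w - L b w * L c v)
     - L a v * (L b u * L c w - L b w * L c u)
     + L a w * (L b u * L c v - L b v * L c u) \<in> critical_ideal N E 3"
  using minor_in_critical_ideal[of 3 "[a, b, c]" "[u, v, w]"] assms
  by (simp add: det_mat_3)

text \<open>The co-rank counts indices, so orders 1 and 2 must be trivial too. The induced path
  \<open>a\<close>, \<open>b\<close>, \<open>c\<close> ensures this, and each obstruction only has
  to exhibit a unit of order 3.\<close>

lemma alg_corank_ge_3:
  assumes unit: "1 \<in> critical_ideal N E 3 \<or> -1 \<in> critical_ideal N E 3"
    and V: "{a, b, c} \<subseteq> {..<N}" and P3: "E a b" "E b c" "\<not> E a c" "a \<noteq> c"
  shows "\<not> alg_corank N E \<le> 2"
proof -
  have ne: "a \<noteq> b" "b \<noteq> c"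
    using P3 V E_irrefl by auto
  have N: "3 \<le> N"
    using card_mono[OF finite_lessThan V] ne P3 by simp
  have neg: "critical_ideal N E i = UNIV"
    if "1 \<in> critical_ideal N E i \<or> -1 \<in> critical_ideal N E i" "i \<in> {1, 2, 3}" for i
    using critical_ideal_scale[of i "-1" "-1"] critical_ideal_eq_UNIV[of i] that N by auto
  have "L a b = -1"
    using ne P3 by (simp add: L_def)
  then have 1: "critical_ideal N E 1 = UNIV"
    using minor_1[of a b] V neg by simp
  have "L a b * L b c - L a c * L b b = 1"
    using ne P3 by (simp add: L_def)
  then have 2: "critical_ideal N E 2 = UNIV"
    using minor_2[of a b b c] V ne neg by simp
  have "{1, 2, 3} \<subseteq> {i \<in> {1..N}. critical_ideal N E i = UNIV}"
    using 1 2 neg[of 3] unit N by auto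
  then have "card {1, 2, 3 :: nat} \<le> alg_corank N E"
    unfolding alg_corank_def by (rule card_mono[rotated]) simp
  then show ?thesis by simp
qed

text \<open>Rows \<open>a\<close>, \<open>b\<close>, \<open>c\<close> against columns
  \<open>b\<close>, \<open>c\<close>, \<open>d\<close>, shifted by one step along the path, give a
  triangular matrix with diagonal -1.\<close>

lemma P4_obstruction:
  assumes V: "{a, b, c, d} \<subseteq> {..<N}" and E: "E a b" "E b c" "E c d"
    and nE: "\<not> E a c" "\<not> E a d" "\<not> E b d"
  shows "\<not> alg_corank N E \<le> 2"
proof -
  have ne: "distinct [a, b, c, d]"
    using V E nE E_irrefl E_sym by auto
  have "L a b * (L b c * L c d - L b d * L c c) - L a c * (L b b * L c d - L b d * L c b)
      + L a d * (L b b * L c c - L b c * L c b) = -1"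
    \<comment> \<open>Reversing the list supplies the disequalities in the opposite orientation,
      which unfolding \<open>L\<close> also meets.\<close>
    using V ne iffD2[OF distinct_rev ne] E nE E_sym by (simp add: L_def)
  then have "-1 \<in> critical_ideal N E 3"
    using minor_3[of a b c b c d] V ne iffD2[OF distinct_rev ne] by simp
  with V E nE ne show ?thesis
    by (intro alg_corank_ge_3[of a b c]) auto
qed

text \<open>Among the columns \<open>b\<close>, \<open>w\<close>, \<open>d\<close>, row
  \<open>a\<close> is nonzero only at \<open>w\<close>. Expanding along it removes
  \<open>var w\<close> and leaves a triangular minor.\<close>

lemma cricket_obstruction:
  assumes V: "{a, b, c, d, w} \<subseteq> {..<N}" and ne: "a \<noteq> b"
    and E: "E w a" "E w b" "E w c" "E w d" "E c d"
    and nE: "\<not> E a b" "\<not> E a c" "\<not> E a d" "\<not> E b c" "\<not> E b d"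
  shows "\<not> alg_corank N E \<le> 2"
proof -
  have ne: "distinct [a, b, c, d, w]"
    using V ne E nE E_irrefl E_sym by auto
  have "L a b * (L w w * L c d - L w d * L c w) - L a w * (L w b * L c d - L w d * L c b)
      + L a d * (L w b * L c w - L w w * L c b) = 1"
    using V ne iffD2[OF distinct_rev ne] E nE E_sym by (simp add: L_def)
  then have "1 \<in> critical_ideal N E 3"
    using minor_3[of a w c b w d] V ne iffD2[OF distinct_rev ne] by simp
  with V E nE ne show ?thesis
    using E_sym by (intro alg_corank_ge_3[of a w b]) auto
qed

text \<open>Row \<open>a\<close> is nonzero only in column \<open>w\<close>, which removes
  \<open>var w\<close>; the rows \<open>w\<close>, \<open>b\<close> and columns \<open>c\<close>,
  \<open>d\<close> that remain have minor -1 since \<open>b\<close> and \<open>d\<close> are not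
  adjacent.\<close>

lemma dart_obstruction:
  assumes V: "{a, b, c, d, w} \<subseteq> {..<N}" and ne: "b \<noteq> d"
    and E: "E w a" "E w b" "E w c" "E w d" "E b c" "E c d"
    and nE: "\<not> E a b" "\<not> E a c" "\<not> E a d" "\<not> E b d"
  shows "\<not> alg_corank N E \<le> 2"
proof -
  have ne: "distinct [a, b, c, d, w]"
    using V ne E nE E_irrefl E_sym by auto
  have "L a w * (L w c * L b d - L w d * L b c) - L a c * (L w w * L b d - L w d * L b w)
      + L a d * (L w w * L b c - L w c * L b w) = 1"
    using V ne iffD2[OF distinct_rev ne] E nE E_sym by (simp add: L_def)
  then have "1 \<in> critical_ideal N E 3"
    using minor_3[of a w b w c d] V ne iffD2[OF distinct_rev ne] by simp
  with V E nE ne show ?thesis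
    using E_sym by (intro alg_corank_ge_3[of a w b]) auto
qed

text \<open>Two minors are combined: \<open>var b + 1\<close>, and one equal to
  \<open>(var a + 1) * (var b + 1) - 1\<close>. Subtracting a multiple of the first from the second
  leaves -1.\<close>

lemma K5_minus_P3_obstruction:
  assumes V: "{a, b, c, u, v} \<subseteq> {..<N}"
    and E: "E b c" "E u v" "E u a" "E u b" "E u c" "E v a" "E v b" "E v c"
    and nE: "\<not> E a b" "\<not> E a c" "a \<noteq> b" "a \<noteq> c"
  shows "\<not> alg_corank N E \<le> 2"
proof -
  have ne: "distinct [a, b, c, u, v]"
    using V E nE E_irrefl E_sym by auto
  let ?I = "critical_ideal N E 3"
  have N: "3 \<le> N"
    using card_mono[OF finite_lessThan V] ne by simp
  have "L a b * (L b c * L u v - L b v * L u c) - L a c * (L b b * L u v - L b v * L u b)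
      + L a v * (L b b * L u c - L b c * L u b) = var b + 1"
    using V ne iffD2[OF distinct_rev ne] E nE E_sym by (simp add: L_def)
  then have 1: "var b + 1 \<in> ?I"
    using minor_3[of a b u b c v] V ne iffD2[OF distinct_rev ne] by simp
  have "L b a * (L a b * L u v - L a v * L u b) - L b b * (L a a * L u v - L a v * L u a)
      + L b v * (L a a * L u b - L a b * L u a) = var b * (var a + 1) + var a"
    using V ne iffD2[OF distinct_rev ne] E nE E_sym by (simp add: L_def algebra_simps)
  then have 2: "var b * (var a + 1) + var a \<in> ?I"
    using minor_3[of b a u a b v] V ne iffD2[OF distinct_rev ne] by simp
  have "(var b * (var a + 1) + var a) + (- (var a + 1)) * (var b + 1) = (-1 :: mpoly_int)"
    by (simp add: algebra_simps)
  then have "-1 \<in> ?I"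
    using critical_ideal_add[OF _ N 2 critical_ideal_scale[OF _ N 1, of "- (var a + 1)"]] by simp
  with V E nE ne show ?thesis
    using E_sym by (intro alg_corank_ge_3[of a u b]) auto
qed

text \<open>Each non-adjacent pair, and the pair \<open>u\<close>, \<open>v\<close>, gives one row
  and one column. Rows and columns are then disjoint and no variable occurs.\<close>

lemma K6_minus_2K2_obstruction:
  assumes V: "{a, b, c, d, u, v} \<subseteq> {..<N}"
    and E: "E a c" "E a d" "E b c" "E b d" "E u v" "E u a" "E u b" "E u c" "E u d"
      "E v a" "E v b" "E v c" "E v d"
    and nE: "\<not> E a b" "\<not> E c d" "a \<noteq> b" "c \<noteq> d"
  shows "\<not> alg_corank N E \<le> 2"
proof -
  have ne: "distinct [a, b, c, d, u, v]"
    using V E nE E_irrefl E_sym by auto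
  have "L a b * (L c d * L u v - L c v * L u d) - L a d * (L c b * L u v - L c v * L u b)
      + L a v * (L c b * L u d - L c d * L u b) = -1"
    using V ne iffD2[OF distinct_rev ne] E nE E_sym by (simp add: L_def)
  then have "-1 \<in> critical_ideal N E 3"
    using minor_3[of a c u b d v] V ne iffD2[OF distinct_rev ne] by simp
  with V E nE ne show ?thesis
    using E_sym by (intro alg_corank_ge_3[of a c b]) auto
qed

end

section \<open>Structure of the graphs without obstructions\<close>

text \<open>A map to the parts suffices: each vertex serves as its own index within its part, which
  makes the embedding injective and \<open>N\<close> a sufficient size.\<close>

lemma induced_subgraph_K3I:
  fixes c :: "nat \<Rightarrow> nat"
  assumes "\<And>u. u < N \<Longrightarrow> c u \<le> 2"
    and "\<And>u v. u < N \<Longrightarrow> v < N \<Longrightarrow> E u v \<longleftrightarrow> c u \<noteq> c v"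
  shows "induced_subgraph_of N E (K3_verts N N N) K3_adj"
  unfolding induced_subgraph_of_def
proof (intro exI[of _ "\<lambda>u. (c u, u)"] conjI allI impI)
  have "c u \<in> {0, 1, 2}" if "u < N" for u
    using assms(1)[OF that] by auto
  then show "(\<lambda>u. (c u, u)) ` {0..<N} \<subseteq> K3_verts N N N"
    by (fastforce simp: K3_verts_def three_parts_def)
qed (auto simp: inj_on_def K3_adj_def assms(2))

lemma induced_subgraph_TKI:
  fixes c :: "nat \<Rightarrow> nat"
  assumes "\<And>u. u < N \<Longrightarrow> c u \<le> 2" and "\<And>u. u < N \<Longrightarrow> \<not> E u u"
    and "\<And>u v. u < N \<Longrightarrow> v < N \<Longrightarrow> u \<noteq> v \<Longrightarrow>
      E u v \<longleftrightarrow> c u = 0 \<and> c v \<noteq> 0 \<or> c u \<noteq> 0 \<and> c v = 0 \<or> c u \<noteq> 0 \<and> c u = c v"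
  shows "induced_subgraph_of N E (TK_verts N N N) TK_adj"
  unfolding induced_subgraph_of_def
proof (intro exI[of _ "\<lambda>u. (c u, u)"] conjI allI impI)
  have "c u \<in> {0, 1, 2}" if "u < N" for u
    using assms(1)[OF that] by auto
  then show "(\<lambda>u. (c u, u)) ` {0..<N} \<subseteq> TK_verts N N N"
    by (fastforce simp: TK_verts_def three_parts_def)
  show "E u v \<longleftrightarrow> TK_adj (c u, u) (c v, v)" if "u < N" "v < N" for u v
    using assms(2,3) that by (cases "u = v") (auto simp: TK_adj_def)
qed (auto simp: inj_on_def)

section \<open>Connected graphs of co-rank at most two\<close>

locale corank_le_2_graph = labelled_graph +
  assumes connected: "connected_graph N E" and corank: "alg_corank N E \<le> 2"
begin

lemma no_P4:
  "\<lbrakk>a < N; b < N; c < N; d < N; E a b; E b c; E c d; \<not> E a c; \<not> E a d; \<not> E b d\<rbrakk> \<Longrightarrow> False"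
  using P4_obstruction[of a b c d] corank by simp

lemma no_cricket:
  "\<lbrakk>a < N; b < N; c < N; d < N; w < N; a \<noteq> b; E w a; E w b; E w c; E w d; E c d;
    \<not> E a b; \<not> E a c; \<not> E a d; \<not> E b c; \<not> E b d\<rbrakk> \<Longrightarrow> False"
  using cricket_obstruction[of a b c d w] corank by simp

lemma no_dart:
  "\<lbrakk>a < N; b < N; c < N; d < N; w < N; b \<noteq> d; E w a; E w b; E w c; E w d; E b c; E c d;
    \<not> E a b; \<not> E a c; \<not> E a d; \<not> E b d\<rbrakk> \<Longrightarrow> False"
  using dart_obstruction[of a b c d w] corank by simp

lemma no_K5_minus_P3:
  "\<lbrakk>a < N; b < N; c < N; u < N; v < N; E b c; E u v; E u a; E u b; E u c; E v a; E v b; E v c;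
    \<not> E a b; \<not> E a c; a \<noteq> b; a \<noteq> c\<rbrakk> \<Longrightarrow> False"
  using K5_minus_P3_obstruction[of a b c u v] corank by simp

lemma no_K6_minus_2K2:
  "\<lbrakk>a < N; b < N; c < N; d < N; u < N; v < N; E a c; E a d; E b c; E b d; E u v;
    E u a; E u b; E u c; E u d; E v a; E v b; E v c; E v d;
    \<not> E a b; \<not> E c d; a \<noteq> b; c \<noteq> d\<rbrakk> \<Longrightarrow> False"
  using K6_minus_2K2_obstruction[of a b c d u v] corank by simp

text \<open>A connected graph without induced P4 has diameter at most 2; the induction follows a
  walk from \<open>x\<close>.\<close>

lemma common_neighbour:
  assumes xy: "x < N" "y < N" "x \<noteq> y" "\<not> E x y"
  obtains z where "z < N" "E x z" "E z y"
proof -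
  let ?R = "{(a, b). a < N \<and> b < N \<and> E a b}"
  have "(x, y) \<in> ?R\<^sup>*"
    using connected xy by (simp add: connected_graph_def)
  then have "y < N \<and> (x = y \<or> E x y \<or> (\<exists>z<N. E x z \<and> E z y))"
  proof (induction rule: rtrancl_induct)
    case base
    then show ?case using xy by simp
  next
    case (step y z)
    then have z: "y < N" "z < N" "E y z" by auto
    consider "x = y" | "E x y" | w where "w < N" "E x w" "E w y"
      using step by blast
    then show ?case
    proof cases
      \<comment> \<open>The walk \<open>x\<close>, \<open>w\<close>, \<open>y\<close>,
        \<open>z\<close> is no induced P4, and any chord brings \<open>z\<close> within distance 2
        of \<open>x\<close>.\<close>
      case 3
      then show ?thesis
        using no_P4[of x w y z] z xy(1) E_sym by blast
    qed (use z in blast)+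
  qed
  then show thesis
    using xy that by blast
qed

text \<open>The parts are the classes of non-adjacency. The case split asks for two different parts
  with two vertices each, witnessed by \<open>a\<close>, \<open>b\<close> and \<open>c\<close>,
  \<open>d\<close>.\<close>

lemma complete_multipartite_case:
  assumes trans: "\<And>a b c. \<lbrakk>a < N; b < N; c < N; \<not> E a b; \<not> E a c\<rbrakk> \<Longrightarrow> \<not> E b c"
  shows "induced_subgraph_of N E (K3_verts N N N) K3_adj \<or>
    induced_subgraph_of N E (TK_verts N N N) TK_adj"
proof (cases "\<exists>a b c d. {a, b, c, d} \<subseteq> {..<N} \<and> a \<noteq> b \<and> \<not> E a b \<and>
    c \<noteq> d \<and> \<not> E c d \<and> E a c")
  case True
  then obtain a b c d where *: "a < N" "b < N" "c < N" "d < N"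
      "a \<noteq> b" "\<not> E a b" "c \<noteq> d" "\<not> E c d" "E a c"
    by auto
  \<comment> \<open>Non-adjacent vertices have the same neighbours, by contraposition of
    \<open>trans\<close>.\<close>
  have inherit: "E y z" if "x < N" "y < N" "z < N" "\<not> E x y" "E x z" for x y z
    using trans[of y x z] that E_sym by metis
  have adj: "E b c" "E d a" "E b d"
    using inherit[of a b c] inherit[of c d a] inherit[of a b d] inherit[of c d b] * E_sym by metis+
  \<comment> \<open>An edge among the vertices outside the parts of \<open>a\<close> and
    \<open>c\<close> would complete K6 minus two disjoint edges, so these vertices form at most one
    further part.\<close>
  have rest: "\<not> E u v" if uv: "u < N" "v < N" "E a u" "E c u" "E a v" "E c v" for u v
  proof
    assume "E u v"
    have "E b u" "E b v"
      using inherit[OF *(1,2) _ *(6)] uv by blast+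
    moreover have "E d u" "E d v"
      using inherit[OF *(3,4) _ *(8)] uv by blast+
    ultimately have "E u a" "E u b" "E u c" "E u d" "E v a" "E v b" "E v c" "E v d" "E a d"
      using uv * adj E_sym by metis+
    with no_K6_minus_2K2[of a b c d u v] show False
      using * adj uv(1,2) \<open>E u v\<close> by blast
  qed
  define f :: "nat \<Rightarrow> nat" where "f x = (if \<not> E a x then 0 else if \<not> E c x then 1 else 2)" for x
  have "E u v \<longleftrightarrow> f u \<noteq> f v" if "u < N" "v < N" for u v
  proof -
    have "E v u = E u v"
      using E_sym that by blast
    then show ?thesis
      using trans[OF *(1) that] trans[OF *(3) that] inherit[OF *(1) that] inherit[OF *(3) that]
        inherit[OF *(1) that(2,1)] inherit[OF *(3) that(2,1)] rest[OF that]
      by (auto simp: f_def split: if_splits)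
  qed
  then have "induced_subgraph_of N E (K3_verts N N N) K3_adj"
    by (intro induced_subgraph_K3I[of N f]) (auto simp: f_def)
  then show ?thesis ..
next
  case no: False
  show ?thesis
  proof (cases "\<exists>a b. a < N \<and> b < N \<and> a \<noteq> b \<and> \<not> E a b")
    case True
    then obtain a b where ab: "a < N" "b < N" "a \<noteq> b" "\<not> E a b"
      by blast
    define f :: "nat \<Rightarrow> nat" where "f x = (if \<not> E a x then 0 else 1)" for x
    \<comment> \<open>Otherwise \<open>a\<close>, \<open>b\<close> and \<open>u\<close>,
      \<open>v\<close> would be the two pairs just excluded. So everything outside the part of
      \<open>a\<close> is a single clique.\<close>
    have 1: "E u v" if "u < N" "v < N" "u \<noteq> v" "E a u" for u v
      using no ab that by auto
    have 2: "\<not> E u v" if "u < N" "v < N" "\<not> E a u" "\<not> E a v" for u v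
      using trans ab that by blast
    have "induced_subgraph_of N E (TK_verts N N N) TK_adj"
    proof (rule induced_subgraph_TKI[of N f])
      show "E u v \<longleftrightarrow> f u = 0 \<and> f v \<noteq> 0 \<or> f u \<noteq> 0 \<and> f v = 0 \<or> f u \<noteq> 0 \<and> f u = f v"
        if "u < N" "v < N" "u \<noteq> v" for u v
        using 1[of u v] 1[of v u] 2[of u v] that E_sym by (auto simp: f_def)
    qed (auto simp: f_def E_irrefl)
    then show ?thesis ..
  next
    case False
    \<comment> \<open>The graph is complete, and all its vertices go into one clique.\<close>
    then have "induced_subgraph_of N E (TK_verts N N N) TK_adj"
      by (intro induced_subgraph_TKI[of N "\<lambda>_. 1"]) (auto simp: E_irrefl)
    then show ?thesis ..
  qed
qed

lemma non_multipartite_case: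
  assumes abc: "a < N" "b < N" "c < N" "\<not> E a b" "\<not> E a c" "E b c"
  shows "induced_subgraph_of N E (TK_verts N N N) TK_adj"
proof -
  note sym = E_sym and irrefl = E_irrefl
  have ne: "a \<noteq> b" "a \<noteq> c" "b \<noteq> c"
    using abc sym irrefl by blast+
  have dominating: "E w c" if "w < N" "E a w" "E w b" for w
    using no_P4[of a w b c] that abc sym by blast
  obtain w where w: "w < N" "E a w" "E w b"
    using common_neighbour[of a b] abc ne by blast
  have wc: "E w c"
    using dominating w by blast
  have wne: "w \<noteq> a" "w \<noteq> b" "w \<noteq> c"
    using w wc irrefl by blast+
  have adj: "E w a" "E b w" "E c w" "E c b" "\<not> E b a" "\<not> E c a"
    using abc w wc sym by blast+
  note base = abc ne w wc wne adj
  \<comment> \<open>\<open>T\<close> will be the independent part and contains \<open>w\<close>;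
    \<open>A\<close> and \<open>B\<close> will be the two cliques, with \<open>a\<close> in
    \<open>A\<close> and \<open>b\<close>, \<open>c\<close> in \<open>B\<close>.\<close>
  define T where "T x \<longleftrightarrow> E x a \<and> E x b \<and> E x c" for x
  define A where "A x \<longleftrightarrow> (x = a \<or> E x a) \<and> E x w \<and> \<not> E x b \<and> \<not> E x c" for x
  define B where "B x \<longleftrightarrow> (x = b \<or> E x b) \<and> (x = c \<or> E x c) \<and> E x w \<and> \<not> E x a" for x
  have classify: "T x \<or> A x \<or> B x" if x: "x < N" for x
  proof (cases "x \<in> {a, b, c, w}")
    case True
    then show ?thesis
      using base unfolding T_def A_def B_def by blast
  next
    case False
    then have ne: "x \<noteq> a" "x \<noteq> b" "x \<noteq> c" "x \<noteq> w" by auto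
    note xs = E_sym[OF x]
    show ?thesis
    proof (cases "E x w")
      case xw: True
      \<comment> \<open>Of the eight adjacency patterns to \<open>a\<close>, \<open>b\<close>,
        \<open>c\<close>, only the one seeing just \<open>b\<close> and \<open>c\<close> (in
        \<open>B\<close>) and the one seeing just \<open>a\<close> (in \<open>A\<close>)
        survive.\<close>
      consider "\<not> E x a" "\<not> E x b" "\<not> E x c" | "\<not> E x a" "E x b" "\<not> E x c"
        | "\<not> E x a" "\<not> E x b" "E x c" | "\<not> E x a" "E x b" "E x c"
        | "E x a" "\<not> E x b" "\<not> E x c" | "E x a" "E x b" "\<not> E x c"
        | "E x a" "\<not> E x b" "E x c" | "E x a" "E x b" "E x c"
        by blast
      then show ?thesis
      proof cases
        case 1
        then show ?thesis using no_cricket[of a x b c w] base x ne xw xs by metis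
      next
        case 2
        then show ?thesis using no_dart[of a x b c w] base x ne xw xs by metis
      next
        case 3
        then show ?thesis using no_dart[of a x c b w] base x ne xw xs by metis
      next
        case 6
        then show ?thesis using no_P4[of c b x a] base x ne xw xs by metis
      next
        case 7
        then show ?thesis using no_P4[of b c x a] base x ne xw xs by metis
      next
        case 8
        then show ?thesis using no_K5_minus_P3[of a b c w x] base x ne xw xs by metis
      qed (use xw in \<open>auto simp: A_def B_def\<close>)
    next
      case xw: False
      consider "\<not> E x a" "\<not> E x b" "\<not> E x c" | "E x a" "\<not> E x b" | "E x a" "E x b"
        | "\<not> E x a" "E x b" | "\<not> E x a" "\<not> E x b" "E x c"
        by blast
      then show ?thesis
      proof cases
        case 1
        \<comment> \<open>By P4-freeness a common neighbour \<open>y\<close> of \<open>x\<close> and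
          \<open>w\<close> sees \<open>a\<close>, \<open>b\<close> and \<open>c\<close>, so
          \<open>y\<close> and \<open>w\<close> complete K5 minus P3.\<close>
        obtain y where y: "y < N" "E x y" "E y w"
          using common_neighbour[of x w] x w ne xw by blast
        have "E y a"
          using no_P4[of x y w a] base x y 1 xw by blast
        moreover have "E y b"
          using no_P4[of x y w b] base x y 1 xw by blast
        moreover have "E y c"
          using no_P4[of x y w c] base x y 1 xw by blast
        ultimately show ?thesis
          using no_K5_minus_P3[of a b c y w] base y by blast
      next
        case 2
        then show ?thesis using no_P4[of x a w b] base x xw by metis
      next
        case 3
        then show ?thesis using no_P4[of c b x a] base x xw xs unfolding T_def by metis
      next
        case 4
        then show ?thesis using no_P4[of x b w a] base x xw by metis
      next
        case 5
        then show ?thesis using no_P4[of x c w a] base x xw by metis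
      qed
    qed
  qed
  \<comment> \<open>A pair violating these rules completes a forbidden graph: K5 minus P3 for
    \<open>TT\<close>, an induced P4 for \<open>TA\<close>, \<open>TB\<close> and \<open>AB\<close>,
    and for \<open>AA\<close> and \<open>BB\<close> a dart whose pendant vertex at \<open>w\<close>
    is taken from the opposite clique.\<close>
  have TT: "\<not> E x y" if "x < N" "y < N" "T x" "T y" for x y
    using no_K5_minus_P3[of a b c x y] that base unfolding T_def by blast
  have TA: "E x y" if "x < N" "y < N" "T x" "A y" for x y
    using no_P4[of y a x b] that base sym unfolding T_def A_def by metis
  have TB: "E x y" if "x < N" "y < N" "T x" "B y" for x y
    using no_P4[of y b x a] that base sym unfolding T_def B_def by metis
  have AA: "E x y" if "x < N" "y < N" "x \<noteq> y" "A x" "A y" for x y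
    using no_dart[of b x a y w] that base sym unfolding A_def by metis
  have AB: "\<not> E x y" if "x < N" "y < N" "A x" "B y" for x y
    using no_P4[of a x y b] that base sym unfolding A_def B_def by metis
  have BB: "E x y" if "x < N" "y < N" "x \<noteq> y" "B x" "B y" for x y
    using no_dart[of a x b y w] that base sym unfolding B_def by metis
  have disj: "\<not> (T x \<and> A x)" "\<not> (T x \<and> B x)" "\<not> (A x \<and> B x)" if "x < N" for x
    using that base unfolding T_def A_def B_def by blast+
  define f :: "nat \<Rightarrow> nat" where "f x = (if T x then 0 else if A x then 1 else 2)" for x
  show ?thesis
  proof (rule induced_subgraph_TKI[of N f])
    fix u v assume uv: "u < N" "v < N" "u \<noteq> v"
    show "E u v \<longleftrightarrow> f u = 0 \<and> f v \<noteq> 0 \<or> f u \<noteq> 0 \<and> f v = 0 \<or> f u \<noteq> 0 \<and> f u = f v"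
      using classify[OF uv(1)] classify[OF uv(2)] disj[OF uv(1)] disj[OF uv(2)]
        TT[of u v] TA[of u v] TB[of u v] AA[of u v] AB[of u v] BB[of u v]
        TA[of v u] TB[of v u] AB[of v u] sym[of u v] uv
      by (elim disjE) (simp_all add: f_def)
  qed (auto simp: f_def irrefl)
qed

lemma induced_subgraph_K3_or_TK:
  "induced_subgraph_of N E (K3_verts N N N) K3_adj \<or>
    induced_subgraph_of N E (TK_verts N N N) TK_adj"
proof (cases "\<exists>a b c. a < N \<and> b < N \<and> c < N \<and> \<not> E a b \<and> \<not> E a c \<and> E b c")
  case True
  then show ?thesis
    using non_multipartite_case by blast
next
  case False
  then show ?thesis
    by (intro complete_multipartite_case) blast
qed

end

theorem theorem4p2:
  fixes N :: nat and E :: "nat \<Rightarrow> nat \<Rightarrow> bool"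
  assumes "simple_graph N E" and "connected_graph N E"
  shows "alg_corank N E \<le> 2 \<longleftrightarrow>
    (\<exists>m n q::nat. induced_subgraph_of N E (K3_verts m n q) K3_adj \<or>
             induced_subgraph_of N E (TK_verts n m q) TK_adj)"
proof
  assume "alg_corank N E \<le> 2"
  with assms interpret corank_le_2_graph N E
    by unfold_locales
  show "\<exists>m n q. induced_subgraph_of N E (K3_verts m n q) K3_adj \<or>
      induced_subgraph_of N E (TK_verts n m q) TK_adj"
    using induced_subgraph_K3_or_TK by blast
next
  assume "\<exists>m n q. induced_subgraph_of N E (K3_verts m n q) K3_adj \<or>
      induced_subgraph_of N E (TK_verts n m q) TK_adj"
  then show "alg_corank N E \<le> 2"
    using alg_corank_le_2_K3 alg_corank_le_2_TK by blast
qed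

end
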